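(* Let $0<p\le 1$. There is a constant $C>0$, independent of $n$, such that the following holds for all integers $n\ge 2$ and $K\ge 1$: if $T:\ell_p^n\to \ell_\infty^K$ and $P:\ell_\infty^K\to \ell_p^n$ are linear maps with $PT=\mathrm{Id}_{\ell_p^n}$ and $\|T\|=1$, then $$\|P\|\ \ge\ C\, n^{\frac1p-\frac12}(\log n)^{-\frac12}.$$
   Context: Scalars are real. $\ell_p^n$ is $\mathbb{R}^n$ with the quasi-norm $\|x\|_p=\left(\sum_{i=1}^n|x_i|^p\right)^{1/p}$, and $\ell_\infty^K$ is $\mathbb{R}^K$ with the sup norm. The norm of a linear operator $S:X\to Y$ between quasi-normed spaces is $\|S\|=\sup\{\|Sx\|:\|x\|\le 1\}$. The constant $C$ does not depend on $n$, $K$, $T$ or $P$. *)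

theory Defs
  imports "Jordan_Normal_Form.VS_Connect" Complex_Main
begin

text \<open>\<open>\<real>\<^sup>n\<close> is \<open>carrier_vec n\<close>, with linear structure \<open>module_vec TYPE(real) n\<close>; the
  dimension is a term and not a type, so that a constant can be chosen before it.\<close>

definition lp_norm :: "real \<Rightarrow> real vec \<Rightarrow> real" where
  "lp_norm p x = (\<Sum>i<dim_vec x. \<bar>x $ i\<bar> powr p) powr (1 / p)"

text \<open>Meaningful in positive dimension only, the maximum being over a nonempty set.\<close>

definition linf_norm :: "real vec \<Rightarrow> real" where
  "linf_norm x = (MAX i\<in>{..<dim_vec x}. \<bar>x $ i\<bar>)"

text \<open>Norm of \<open>S\<close> on \<open>\<real>\<^sup>m\<close> with the quasi-norm \<open>N\<close> on the source and \<open>N'\<close> on the target.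
  For \<open>S\<close> linear between the spaces above, the supremum is over a bounded set that
  contains \<open>0\<close>, so the conditionally complete \<open>Sup\<close> of the reals is the true supremum.\<close>

definition op_norm ::
    "nat \<Rightarrow> (real vec \<Rightarrow> real) \<Rightarrow> (real vec \<Rightarrow> real) \<Rightarrow> (real vec \<Rightarrow> real vec) \<Rightarrow> real" where
  "op_norm m N N' S = (SUP x\<in>{x \<in> carrier_vec m. N x \<le> 1}. N' (S x))"

abbreviation linear_vec_map :: "nat \<Rightarrow> nat \<Rightarrow> (real vec \<Rightarrow> real vec) \<Rightarrow> bool" where
  "linear_vec_map m k S \<equiv>
     linear_map class_ring (module_vec TYPE(real) m) (module_vec TYPE(real) k) S"

end

theory Submission
  imports Defs
begin

text \<open>Let \<open>t\<close> and \<open>q\<close> be the matrices of \<open>T\<close> and \<open>P\<close>. Testing \<open>T\<close> on unit vectors shows that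
  the entries of \<open>t\<close> lie in \<open>[-1, 1]\<close>. If \<open>e\<close> is a vector of \<open>n\<close> random signs, every coordinate
  of \<open>T e\<close> is therefore a subgaussian variable of size at most about \<open>sqrt n\<close>, while \<open>P (T e) = e\<close> has
  quasi-norm \<open>n powr (1 / p)\<close>. If all coordinates of \<open>T e\<close> were at most \<open>b\<close>, with \<open>b\<close> of order
  \<open>sqrt (n ln n)\<close>, the vector \<open>T e / b\<close> would witness \<open>\<parallel>P\<parallel> \<ge> n powr (1 / p) / b\<close>, which is the
  claim.

  A union bound over the coordinates would cost a factor depending on \<open>K\<close>. Instead \<open>T e\<close> is
  truncated to the cube \<open>[-b, b]\<close>. The discarded part has coordinates whose mean absolute value is
  at most a large negative power of \<open>n\<close>, and \<open>P\<close> maps it to something small because the \<open>l\<^sub>1\<close> norm of each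
  row of \<open>q\<close> is at most \<open>\<parallel>P\<parallel>\<close> (test \<open>P\<close> on the signs of the row), which may be assumed to be at
  most \<open>n powr (1 / p - 1 / 2)\<close>, for otherwise the claim holds anyway. So for some
  choice of signs the truncated vector is still mapped to a vector all of whose coordinates are at least \<open>1 / 2\<close> in absolute value
  (\<open>left_inverse_bounded_preimage\<close>), and \<open>op_norm_left_inverse_ge\<close> follows; the choice of \<open>b\<close> is
  made in \<open>truncation_height_suffices\<close>.

  Expectations over random signs are written as sums over the subsets \<open>A\<close> of \<open>{..<n}\<close>, the set
  of indices with sign \<open>+1\<close>.\<close>

section \<open>Random signs and truncation\<close>

definition sign :: "nat set \<Rightarrow> nat \<Rightarrow> real" where
  "sign A i = (if i \<in> A then 1 else - 1)"

definition clip :: "real \<Rightarrow> real \<Rightarrow> real" where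
  "clip b u = max (- b) (min b u)"

lemma abs_sign [simp]: "\<bar>sign A i\<bar> = 1"
  by (simp add: sign_def)

lemma sum_signs_exp:
  "(\<Sum>A\<in>Pow {..<n}. exp (\<Sum>i<n. a i * sign A i)) = (\<Prod>i<n. exp (a i) + exp (- a i))"
proof -
  have "exp (\<Sum>i<n. a i * sign A i) = (\<Prod>i\<in>A. exp (a i)) * (\<Prod>i\<in>{..<n} - A. exp (- a i))"
    if "A \<in> Pow {..<n}" for A
  proof -
    have "exp (\<Sum>i<n. a i * sign A i) = (\<Prod>i<n. exp (a i * sign A i))"
      by (simp add: exp_sum)
    also have "\<dots> = (\<Prod>i\<in>{..<n} - A. exp (a i * sign A i)) * (\<Prod>i\<in>A. exp (a i * sign A i))"
      using that by (intro prod.subset_diff) auto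
    finally show ?thesis
      by (simp add: sign_def mult.commute)
  qed
  then show ?thesis
    by (simp add: prod_add)
qed

text \<open>For \<open>\<bar>t\<bar> \<le> 1\<close> the linear terms of \<open>exp t \<le> 1 + t + t\<^sup>2\<close> and its mirror image cancel; for
  \<open>\<bar>t\<bar> \<ge> 1\<close> already \<open>\<bar>t\<bar> \<le> t\<^sup>2\<close>.\<close>

lemma exp_symmetric_le:
  fixes t :: real
  shows "exp t + exp (- t) \<le> 2 * exp (t\<^sup>2)"
proof -
  have pos: "exp t + exp (- t) \<le> 2 * exp (t\<^sup>2)" if t: "t \<ge> 0" for t :: real
  proof (cases "t \<le> 1")
    case True
    have "exp t \<le> 1 + t + t\<^sup>2"
      using t True by (rule exp_bound)
    moreover have "exp (- t) \<le> 1 - t + t\<^sup>2"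
    proof -
      have "1 \<le> (1 + t) * (1 - t + t\<^sup>2)"
        using t by (simp add: algebra_simps power2_eq_square)
      also have "\<dots> \<le> exp t * (1 - t + t\<^sup>2)"
        using t True by (intro mult_right_mono exp_ge_add_one_self) auto
      finally show ?thesis
        by (simp add: exp_minus field_simps)
    qed
    moreover have "1 + t\<^sup>2 \<le> exp (t\<^sup>2)"
      by (rule exp_ge_add_one_self)
    ultimately show ?thesis
      by linarith
  next
    case False
    then have "t \<le> t\<^sup>2"
      by (simp add: power2_eq_square)
    then have "exp t \<le> exp (t\<^sup>2)" "exp (- t) \<le> exp (t\<^sup>2)"
      using t by auto
    then show ?thesis
      by linarith
  qed
  show ?thesis
    using pos[of t] pos[of "- t"] by (cases "t \<ge> 0") auto
qed

lemma sum_signs_exp_abs_le: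
  fixes a :: "nat \<Rightarrow> real"
  assumes "\<And>i. i < n \<Longrightarrow> \<bar>a i\<bar> \<le> s"
  shows "(\<Sum>A\<in>Pow {..<n}. exp \<bar>\<Sum>i<n. a i * sign A i\<bar>) \<le> 2 * 2 ^ n * exp (real n * s\<^sup>2)"
proof -
  have one_sided: "(\<Sum>A\<in>Pow {..<n}. exp (\<Sum>i<n. b i * sign A i)) \<le> 2 ^ n * exp (real n * s\<^sup>2)"
    if b: "\<And>i. i < n \<Longrightarrow> \<bar>b i\<bar> \<le> s" for b :: "nat \<Rightarrow> real"
  proof -
    have "(\<Prod>i<n. exp (b i) + exp (- b i)) \<le> (\<Prod>i<n. 2 * exp (s\<^sup>2))"
    proof (intro prod_mono conjI)
      fix i assume "i \<in> {..<n}"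
      then have "(b i)\<^sup>2 \<le> s\<^sup>2"
        using b[of i] by (simp add: abs_le_square_iff[symmetric])
      then show "exp (b i) + exp (- b i) \<le> 2 * exp (s\<^sup>2)"
        using exp_symmetric_le[of "b i"] by (smt (verit) exp_le_cancel_iff)
    qed (simp add: add_nonneg_nonneg)
    then show ?thesis
      by (simp add: sum_signs_exp power_mult_distrib exp_of_nat_mult)
  qed
  have "(\<Sum>A\<in>Pow {..<n}. exp \<bar>\<Sum>i<n. a i * sign A i\<bar>)
      \<le> (\<Sum>A\<in>Pow {..<n}. exp (\<Sum>i<n. a i * sign A i) + exp (\<Sum>i<n. - a i * sign A i))"
    by (intro sum_mono) (auto simp: sum_negf abs_if)
  also have "\<dots> \<le> 2 ^ n * exp (real n * s\<^sup>2) + 2 ^ n * exp (real n * s\<^sup>2)"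
    unfolding sum.distrib using assms by (intro add_mono one_sided) auto
  finally show ?thesis
    by simp
qed

lemma abs_clip_le: "b \<ge> 0 \<Longrightarrow> \<bar>clip b u\<bar> \<le> b"
  by (simp add: clip_def)

text \<open>Dominating the error by an exponential reduces its mean to exponential moments, which
  factor over independent signs.\<close>

lemma clip_error_le:
  assumes "b \<ge> 0" "s > 0"
  shows "\<bar>u - clip b u\<bar> \<le> exp (s * (\<bar>u\<bar> - b)) / s"
proof (cases "\<bar>u\<bar> \<le> b")
  case True
  then show ?thesis
    using assms by (simp add: clip_def abs_le_iff)
next
  case False
  have "s * (\<bar>u\<bar> - b) \<le> exp (s * (\<bar>u\<bar> - b))"
    using exp_ge_add_one_self[of "s * (\<bar>u\<bar> - b)"] by linarith
  then have "\<bar>u\<bar> - b \<le> exp (s * (\<bar>u\<bar> - b)) / s"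
    using assms by (simp add: pos_le_divide_eq mult.commute)
  moreover have "\<bar>u - clip b u\<bar> = \<bar>u\<bar> - b"
    using False assms by (auto simp: clip_def)
  ultimately show ?thesis
    by simp
qed

text \<open>A sum of \<open>n\<close> signs with coefficients in \<open>[-1, 1]\<close> has Gaussian tails of variance of order
  at most \<open>n\<close>, so cutting it at height \<open>b\<close> changes it very little on average once \<open>b\<close> is well above
  \<open>sqrt n\<close>.\<close>

lemma sum_signs_clip_error_le:
  fixes a :: "nat \<Rightarrow> real"
  assumes a: "\<And>i. i < n \<Longrightarrow> \<bar>a i\<bar> \<le> 1" and "b > 0" and "n > 0"
  defines "S \<equiv> \<lambda>A. \<Sum>i<n. a i * sign A i"
  shows "(\<Sum>A\<in>Pow {..<n}. \<bar>S A - clip b (S A)\<bar>)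
           \<le> 2 ^ n * (4 * real n / b * exp (- (b\<^sup>2 / (4 * real n))))"
proof -
  \<comment> \<open>This value of \<open>s\<close> minimises the final exponent \<open>n s\<^sup>2 - s b\<close>.\<close>
  define s where "s = b / (2 * real n)"
  have s: "s > 0"
    using assms by (simp add: s_def)
  have "(\<Sum>A\<in>Pow {..<n}. \<bar>S A - clip b (S A)\<bar>)
      \<le> (\<Sum>A\<in>Pow {..<n}. exp (- (s * b)) / s * exp \<bar>\<Sum>i<n. (s * a i) * sign A i\<bar>)"
  proof (intro sum_mono)
    fix A
    have "\<bar>\<Sum>i<n. (s * a i) * sign A i\<bar> = s * \<bar>S A\<bar>"
      using s by (simp add: S_def mult.assoc sum_distrib_left[symmetric] abs_mult)
    moreover have "exp (s * (\<bar>S A\<bar> - b)) = exp (- (s * b)) * exp (s * \<bar>S A\<bar>)"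
      by (simp add: exp_add[symmetric] algebra_simps)
    ultimately show "\<bar>S A - clip b (S A)\<bar>
        \<le> exp (- (s * b)) / s * exp \<bar>\<Sum>i<n. (s * a i) * sign A i\<bar>"
      using clip_error_le[of b s "S A"] s \<open>b > 0\<close> by simp
  qed
  also have "\<dots> \<le> exp (- (s * b)) / s * (2 * 2 ^ n * exp (real n * s\<^sup>2))"
    unfolding sum_distrib_left[symmetric]
    using s a by (intro mult_left_mono sum_signs_exp_abs_le) (auto simp: abs_mult)
  also have "\<dots> = 2 ^ n * (2 / s * (exp (- (s * b)) * exp (real n * s\<^sup>2)))"
    by simp
  also have "exp (- (s * b)) * exp (real n * s\<^sup>2) = exp (- (b\<^sup>2 / (4 * real n)))"
    using \<open>n > 0\<close> by (simp add: exp_add[symmetric] s_def field_simps power2_eq_square)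
  also have "2 / s = 4 * real n / b"
    by (simp add: s_def)
  finally show ?thesis .
qed

section \<open>Left inverses of matrices with small entries\<close>

text \<open>The heart of the argument. For signs \<open>e\<close>, the matrix \<open>q\<close> sends \<open>t e\<close> back to \<open>e\<close>, and it
  sends the part of \<open>t e\<close> above height \<open>b\<close> to something small on average, whatever the number
  \<open>K\<close> of rows of \<open>t\<close>: only the row sums of \<open>q\<close> matter. Hence some truncated \<open>t e\<close> is sent to a
  vector that is close to \<open>e\<close> in every coordinate.\<close>

lemma left_inverse_bounded_preimage:
  fixes t q :: "nat \<Rightarrow> nat \<Rightarrow> real"
  assumes t: "\<And>k i. k < K \<Longrightarrow> i < n \<Longrightarrow> \<bar>t k i\<bar> \<le> 1"
    and q: "\<And>i. i < n \<Longrightarrow> (\<Sum>k<K. \<bar>q i k\<bar>) \<le> B"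
    and inv: "\<And>i j. i < n \<Longrightarrow> j < n \<Longrightarrow> (\<Sum>k<K. q i k * t k j) = (if i = j then 1 else 0)"
    and "n > 0" "b > 0"
    and small: "real n * B * (4 * real n / b * exp (- (b\<^sup>2 / (4 * real n)))) \<le> 1 / 2"
  obtains z where "\<And>k. \<bar>z k\<bar> \<le> b" and "\<And>i. i < n \<Longrightarrow> \<bar>\<Sum>k<K. q i k * z k\<bar> \<ge> 1 / 2"
proof -
  define S where "S A k = (\<Sum>i<n. t k i * sign A i)" for A k
  define r where "r A k = S A k - clip b (S A k)" for A k
  define E where "E = 4 * real n / b * exp (- (b\<^sup>2 / (4 * real n)))"
  define F where "F A = (\<Sum>i<n. \<Sum>k<K. \<bar>q i k\<bar> * \<bar>r A k\<bar>)" for A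
  have E: "E \<ge> 0"
    using \<open>b > 0\<close> by (simp add: E_def)
  have "(\<Sum>A\<in>Pow {..<n}. F A) = (\<Sum>i<n. \<Sum>k<K. \<bar>q i k\<bar> * (\<Sum>A\<in>Pow {..<n}. \<bar>r A k\<bar>))"
    unfolding F_def
    by (subst sum.swap, intro sum.cong refl, subst sum.swap) (simp add: sum_distrib_left)
  also have "\<dots> \<le> (\<Sum>i<n. \<Sum>k<K. \<bar>q i k\<bar> * (2 ^ n * E))"
    unfolding r_def S_def E_def using t \<open>n > 0\<close> \<open>b > 0\<close>
    by (intro sum_mono mult_left_mono sum_signs_clip_error_le) auto
  also have "\<dots> = (\<Sum>i<n. (\<Sum>k<K. \<bar>q i k\<bar>) * (2 ^ n * E))"
    by (simp add: sum_distrib_right)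
  also have "\<dots> \<le> (\<Sum>i<n. B * (2 ^ n * E))"
    using q E by (intro sum_mono mult_right_mono) auto
  also have "\<dots> = (\<Sum>A\<in>Pow {..<n}. real n * B * E)"
    by (simp add: card_Pow)
  finally have avg: "(\<Sum>A\<in>Pow {..<n}. F A) \<le> (\<Sum>A\<in>Pow {..<n}. real n * B * E)" .
  have "\<exists>A. F A \<le> real n * B * E"
  proof (rule ccontr)
    assume "\<nexists>A. F A \<le> real n * B * E"
    then have "\<And>A. real n * B * E < F A"
      by (auto simp: not_le)
    then have "(\<Sum>A\<in>Pow {..<n}. real n * B * E) < (\<Sum>A\<in>Pow {..<n}. F A)"
      by (intro sum_strict_mono) auto
    then show False
      using avg by simp
  qed
  then obtain A where "F A \<le> real n * B * E"
    by blast
  then have FA: "F A \<le> 1 / 2"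
    using small by (simp add: E_def)
  show thesis
  proof (rule that[of "\<lambda>k. clip b (S A k)"])
    show "\<bar>clip b (S A k)\<bar> \<le> b" for k
      using \<open>b > 0\<close> by (simp add: abs_clip_le)
  next
    fix i assume i: "i < n"
    have "(\<Sum>k<K. q i k * S A k) = (\<Sum>k<K. \<Sum>j<n. (q i k * t k j) * sign A j)"
      unfolding S_def by (simp add: sum_distrib_left mult.assoc)
    also have "\<dots> = (\<Sum>j<n. (\<Sum>k<K. q i k * t k j) * sign A j)"
      by (subst sum.swap) (simp add: sum_distrib_right)
    also have "\<dots> = (\<Sum>j<n. if i = j then sign A j else 0)"
      using inv i by (intro sum.cong) auto
    also have "\<dots> = sign A i"
      using i by simp
    finally have main: "(\<Sum>k<K. q i k * S A k) = sign A i" .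
    have "\<bar>\<Sum>k<K. q i k * r A k\<bar> \<le> (\<Sum>k<K. \<bar>q i k\<bar> * \<bar>r A k\<bar>)"
      using sum_abs[of "\<lambda>k. q i k * r A k" "{..<K}"] by (simp add: abs_mult)
    also have "\<dots> \<le> F A"
      unfolding F_def using i
      by (intro member_le_sum[where f = "\<lambda>i. \<Sum>k<K. \<bar>q i k\<bar> * \<bar>r A k\<bar>"] sum_nonneg) auto
    finally have "\<bar>\<Sum>k<K. q i k * r A k\<bar> \<le> 1 / 2"
      using FA by linarith
    moreover have "(\<Sum>k<K. q i k * clip b (S A k)) = sign A i - (\<Sum>k<K. q i k * r A k)"
      using main by (simp add: r_def right_diff_distrib sum_subtractf)
    ultimately show "\<bar>\<Sum>k<K. q i k * clip b (S A k)\<bar> \<ge> 1 / 2"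
      using abs_sign[of A i] by linarith
  qed
qed

section \<open>Coordinates and operator norms\<close>

lemma linear_vec_map_carrier:
  "linear_vec_map m k S \<Longrightarrow> x \<in> carrier_vec m \<Longrightarrow> S x \<in> carrier_vec k"
  using mod_hom.f_im[of class_ring "module_vec TYPE(real) m" "module_vec TYPE(real) k" S]
  by (auto simp: linear_map_def module_vec_simps)

lemma linear_vec_map_add:
  "linear_vec_map m k S \<Longrightarrow> x \<in> carrier_vec m \<Longrightarrow> y \<in> carrier_vec m \<Longrightarrow> S (x + y) = S x + S y"
  using LinearCombinations.module_hom_add[OF mod_hom.f_hom[OF linear_map.axioms(3)], of class_ring
      "module_vec TYPE(real) m" "module_vec TYPE(real) k" S x y]
  by (simp add: module_vec_simps class_ring_simps)

lemma linear_vec_map_smult: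
  "linear_vec_map m k S \<Longrightarrow> x \<in> carrier_vec m \<Longrightarrow> S (c \<cdot>\<^sub>v x) = c \<cdot>\<^sub>v S x"
  using LinearCombinations.module_hom_smult[OF mod_hom.f_hom[OF linear_map.axioms(3)], of class_ring
      "module_vec TYPE(real) m" "module_vec TYPE(real) k" S c x]
  by (simp add: module_vec_simps class_ring_simps)

lemma linear_vec_map_nth:
  assumes S: "linear_vec_map m k S" and x: "x \<in> carrier_vec m" and i: "i < k"
  shows "S x $ i = (\<Sum>j<m. x $ j * S (unit_vec m j) $ i)"
proof -
  \<comment> \<open>The vector is built up one coordinate at a time, so that additivity suffices.\<close>
  define y where "y l = vec m (\<lambda>j. if j < l then x $ j else 0)" for l
  have y: "y l \<in> carrier_vec m" for l
    by (simp add: y_def)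
  have "l \<le> m \<Longrightarrow> S (y l) $ i = (\<Sum>j<l. x $ j * S (unit_vec m j) $ i)" for l
  proof (induction l)
    case 0
    have "y 0 = 0 \<cdot>\<^sub>v y 0"
      by (auto simp: y_def)
    then have "S (y 0) = 0 \<cdot>\<^sub>v S (y 0)"
      using linear_vec_map_smult[OF S y, of 0 0] by simp
    then have "S (y 0) $ i = (0 \<cdot>\<^sub>v S (y 0)) $ i"
      by simp
    then show ?case
      using linear_vec_map_carrier[OF S y, of 0] i by simp
  next
    case (Suc l)
    have "y (Suc l) = y l + x $ l \<cdot>\<^sub>v unit_vec m l"
      using Suc.prems by (auto simp: y_def less_Suc_eq)
    then have "S (y (Suc l)) = S (y l) + x $ l \<cdot>\<^sub>v S (unit_vec m l)"
      using S y by (simp add: linear_vec_map_add linear_vec_map_smult)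
    then show ?case
      using Suc i linear_vec_map_carrier[OF S y] linear_vec_map_carrier[OF S, of "unit_vec m l"]
      by simp
  qed
  moreover have "y m = x"
    using x by (auto simp: y_def)
  ultimately show ?thesis
    by (metis order_refl)
qed

lemma linf_norm_le_iff:
  "dim_vec x > 0 \<Longrightarrow> linf_norm x \<le> c \<longleftrightarrow> (\<forall>i<dim_vec x. \<bar>x $ i\<bar> \<le> c)"
  unfolding linf_norm_def by (subst Max_le_iff) (auto simp: lessThan_empty_iff)

lemma abs_nth_le_linf_norm: "i < dim_vec x \<Longrightarrow> \<bar>x $ i\<bar> \<le> linf_norm x"
  unfolding linf_norm_def by (intro Max_ge) auto

lemma abs_nth_le_lp_norm:
  assumes "p > 0" "i < dim_vec x"
  shows "\<bar>x $ i\<bar> \<le> lp_norm p x"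
proof -
  have "\<bar>x $ i\<bar> powr p \<le> (\<Sum>i<dim_vec x. \<bar>x $ i\<bar> powr p)"
    using assms by (intro member_le_sum[where f = "\<lambda>i. \<bar>x $ i\<bar> powr p"]) auto
  then have "(\<bar>x $ i\<bar> powr p) powr (1 / p) \<le> lp_norm p x"
    unfolding lp_norm_def using assms by (intro powr_mono2) auto
  then show ?thesis
    using assms by (simp add: powr_powr)
qed

lemma lp_norm_const_le:
  assumes "p > 0" "c \<ge> 0" "\<And>i. i < dim_vec x \<Longrightarrow> c \<le> \<bar>x $ i\<bar>"
  shows "real (dim_vec x) powr (1 / p) * c \<le> lp_norm p x"
proof -
  have "(\<Sum>i<dim_vec x. c powr p) \<le> (\<Sum>i<dim_vec x. \<bar>x $ i\<bar> powr p)"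
    using assms by (intro sum_mono powr_mono2) auto
  then have "(real (dim_vec x) * c powr p) powr (1 / p) \<le> lp_norm p x"
    unfolding lp_norm_def using assms by (intro powr_mono2) auto
  then show ?thesis
    using assms by (simp add: powr_mult powr_powr)
qed

lemma le_lp_norm_const:
  assumes "p > 0" "\<And>i. i < dim_vec x \<Longrightarrow> \<bar>x $ i\<bar> \<le> c" "c \<ge> 0"
  shows "lp_norm p x \<le> real (dim_vec x) powr (1 / p) * c"
proof -
  have "(\<Sum>i<dim_vec x. \<bar>x $ i\<bar> powr p) \<le> (\<Sum>i<dim_vec x. c powr p)"
    using assms by (intro sum_mono powr_mono2) auto
  then have "lp_norm p x \<le> (real (dim_vec x) * c powr p) powr (1 / p)"
    unfolding lp_norm_def using assms by (intro powr_mono2 sum_nonneg) auto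
  then show ?thesis
    using assms by (simp add: powr_mult powr_powr)
qed

lemma linear_vec_map_nth_bounded:
  assumes S: "linear_vec_map m k S"
  obtains c where "c \<ge> 0"
    "\<And>x i. x \<in> carrier_vec m \<Longrightarrow> (\<And>j. j < m \<Longrightarrow> \<bar>x $ j\<bar> \<le> 1) \<Longrightarrow> i < k \<Longrightarrow> \<bar>S x $ i\<bar> \<le> c"
proof
  let ?c = "\<Sum>i<k. \<Sum>j<m. \<bar>S (unit_vec m j) $ i\<bar>"
  show "?c \<ge> 0"
    by (intro sum_nonneg) auto
  fix x :: "real vec" and i
  assume x: "x \<in> carrier_vec m" "\<And>j. j < m \<Longrightarrow> \<bar>x $ j\<bar> \<le> 1" and i: "i < k"
  have "\<bar>S x $ i\<bar> \<le> (\<Sum>j<m. \<bar>x $ j * S (unit_vec m j) $ i\<bar>)"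
    unfolding linear_vec_map_nth[OF S x(1) i] by (rule sum_abs)
  also have "\<dots> \<le> (\<Sum>j<m. 1 * \<bar>S (unit_vec m j) $ i\<bar>)"
    unfolding abs_mult using x by (intro sum_mono mult_right_mono) auto
  also have "\<dots> = (\<Sum>j<m. \<bar>S (unit_vec m j) $ i\<bar>)"
    by simp
  also have "\<dots> \<le> ?c"
    using i
    by (intro member_le_sum[where f = "\<lambda>i. \<Sum>j<m. \<bar>S (unit_vec m j) $ i\<bar>"] sum_nonneg) auto
  finally show "\<bar>S x $ i\<bar> \<le> ?c" .
qed

text \<open>The suprema in the definition of the operator norm are taken in the conditionally complete
  reals, so that boundedness has to be supplied before a value can be compared with them.\<close>

lemma le_op_norm:
  assumes S: "linear_vec_map m k S"
    and N: "\<And>x j. x \<in> carrier_vec m \<Longrightarrow> N x \<le> 1 \<Longrightarrow> j < m \<Longrightarrow> \<bar>x $ j\<bar> \<le> 1"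
    and N': "\<And>c. c \<ge> 0 \<Longrightarrow> \<exists>d. \<forall>y\<in>carrier_vec k. (\<forall>i<k. \<bar>y $ i\<bar> \<le> c) \<longrightarrow> N' y \<le> d"
    and x: "x \<in> carrier_vec m" "N x \<le> 1"
  shows "N' (S x) \<le> op_norm m N N' S"
proof -
  obtain c where c: "c \<ge> 0"
    "\<And>x i. x \<in> carrier_vec m \<Longrightarrow> (\<And>j. j < m \<Longrightarrow> \<bar>x $ j\<bar> \<le> 1) \<Longrightarrow> i < k \<Longrightarrow> \<bar>S x $ i\<bar> \<le> c"
    using linear_vec_map_nth_bounded[OF S] by blast
  obtain d where d: "\<And>y. y \<in> carrier_vec k \<Longrightarrow> (\<forall>i<k. \<bar>y $ i\<bar> \<le> c) \<Longrightarrow> N' y \<le> d"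
    using N'[OF c(1)] by blast
  have "N' (S z) \<le> d" if "z \<in> carrier_vec m" "N z \<le> 1" for z :: "real vec"
    using that c(2) N by (intro d linear_vec_map_carrier[OF S]) auto
  then have "bdd_above ((\<lambda>x. N' (S x)) ` {x \<in> carrier_vec m. N x \<le> 1})"
    by (intro bdd_aboveI2[where M = d]) auto
  then show ?thesis
    unfolding op_norm_def using x by (intro cSUP_upper) auto
qed

lemma linf_norm_le_op_norm:
  assumes S: "linear_vec_map m k S" and "k > 0" "p > 0" and x: "x \<in> carrier_vec m" "lp_norm p x \<le> 1"
  shows "linf_norm (S x) \<le> op_norm m (lp_norm p) linf_norm S"
proof (rule le_op_norm[where N = "lp_norm p" and N' = linf_norm, OF S])
  show "\<bar>x $ j\<bar> \<le> 1" if "x \<in> carrier_vec m" "lp_norm p x \<le> 1" "j < m" for x j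
    using abs_nth_le_lp_norm[OF \<open>p > 0\<close>, of j x] that by auto
  show "\<exists>d. \<forall>y\<in>carrier_vec k. (\<forall>i<k. \<bar>y $ i\<bar> \<le> c) \<longrightarrow> linf_norm y \<le> d" for c
    using \<open>k > 0\<close> by (intro exI[of _ c]) (auto simp: linf_norm_le_iff)
  show "x \<in> carrier_vec m" "lp_norm p x \<le> 1"
    by fact+
qed

lemma lp_norm_le_op_norm:
  assumes S: "linear_vec_map m k S" and "m > 0" "p > 0"
    and x: "x \<in> carrier_vec m" "\<And>j. j < m \<Longrightarrow> \<bar>x $ j\<bar> \<le> 1"
  shows "lp_norm p (S x) \<le> op_norm m linf_norm (lp_norm p) S"
proof (rule le_op_norm[where N = linf_norm and N' = "lp_norm p", OF S])
  show "\<bar>x $ j\<bar> \<le> 1" if "x \<in> carrier_vec m" "linf_norm x \<le> 1" "j < m" for x j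
    using abs_nth_le_linf_norm[of j x] that by auto
  show "\<exists>d. \<forall>y\<in>carrier_vec k. (\<forall>i<k. \<bar>y $ i\<bar> \<le> c) \<longrightarrow> lp_norm p y \<le> d" if "c \<ge> 0" for c
  proof (intro exI[of _ "real k powr (1 / p) * c"] ballI impI)
    fix y assume "y \<in> carrier_vec k" "\<forall>i<k. \<bar>y $ i\<bar> \<le> c"
    then show "lp_norm p y \<le> real k powr (1 / p) * c"
      using le_lp_norm_const[OF \<open>p > 0\<close> _ that, of y] by simp
  qed
  show "x \<in> carrier_vec m"
    by fact
  show "linf_norm x \<le> 1"
    using x \<open>m > 0\<close> by (auto simp: linf_norm_le_iff)
qed

lemma abs_matrix_entry_le_op_norm:
  assumes T: "linear_vec_map n K T" and "p > 0" and k: "k < K" and i: "i < n"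
  shows "\<bar>T (unit_vec n i) $ k\<bar> \<le> op_norm n (lp_norm p) linf_norm T"
proof -
  have "(\<Sum>j<n. \<bar>unit_vec n i $ j\<bar> powr p) = (\<Sum>j<n. if j = i then 1 else (0::real))"
    using i by (intro sum.cong) auto
  then have "lp_norm p (unit_vec n i) \<le> 1"
    using i by (simp add: lp_norm_def)
  then have "linf_norm (T (unit_vec n i)) \<le> op_norm n (lp_norm p) linf_norm T"
    using T k \<open>p > 0\<close> by (intro linf_norm_le_op_norm) auto
  moreover have "\<bar>T (unit_vec n i) $ k\<bar> \<le> linf_norm (T (unit_vec n i))"
    using linear_vec_map_carrier[OF T, of "unit_vec n i"] k by (intro abs_nth_le_linf_norm) auto
  ultimately show ?thesis
    by linarith
qed

text \<open>Test the operator on the sign pattern of the row.\<close>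

lemma matrix_row_sum_le_op_norm:
  assumes P: "linear_vec_map K n P" and "K > 0" "p > 0" and i: "i < n"
  shows "(\<Sum>k<K. \<bar>P (unit_vec K k) $ i\<bar>) \<le> op_norm K linf_norm (lp_norm p) P"
proof -
  define x where "x = vec K (\<lambda>k. sgn (P (unit_vec K k) $ i))"
  have x: "x \<in> carrier_vec K" "\<And>k. k < K \<Longrightarrow> \<bar>x $ k\<bar> \<le> 1"
    by (auto simp: x_def abs_sgn_eq)
  have "(\<Sum>k<K. \<bar>P (unit_vec K k) $ i\<bar>) = P x $ i"
    unfolding linear_vec_map_nth[OF P x(1) i]
    by (intro sum.cong) (auto simp: x_def abs_sgn mult.commute)
  also have "\<dots> \<le> \<bar>P x $ i\<bar>"
    by simp
  also have "\<dots> \<le> lp_norm p (P x)"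
    using linear_vec_map_carrier[OF P x(1)] \<open>p > 0\<close> i by (intro abs_nth_le_lp_norm) auto
  also have "\<dots> \<le> op_norm K linf_norm (lp_norm p) P"
    using P \<open>K > 0\<close> \<open>p > 0\<close> x by (intro lp_norm_le_op_norm) auto
  finally show ?thesis .
qed

section \<open>Lower bounds for the left inverse\<close>

lemma op_norm_left_inverse_ge:
  assumes "p > 0" "n > 0" "K > 0" and T: "linear_vec_map n K T" and P: "linear_vec_map K n P"
    and PT: "\<And>x. x \<in> carrier_vec n \<Longrightarrow> P (T x) = x"
    and T1: "op_norm n (lp_norm p) linf_norm T \<le> 1"
    and PB: "op_norm K linf_norm (lp_norm p) P \<le> B"
    and "b > 0"
    and small: "real n * B * (4 * real n / b * exp (- (b\<^sup>2 / (4 * real n)))) \<le> 1 / 2"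
  shows "op_norm K linf_norm (lp_norm p) P \<ge> real n powr (1 / p) / (2 * b)"
proof -
  obtain z where z: "\<And>k. \<bar>z k\<bar> \<le> b"
    "\<And>i. i < n \<Longrightarrow> \<bar>\<Sum>k<K. P (unit_vec K k) $ i * z k\<bar> \<ge> 1 / 2"
  proof (rule left_inverse_bounded_preimage[of K n "\<lambda>k i. T (unit_vec n i) $ k"
        "\<lambda>i k. P (unit_vec K k) $ i" B b])
    show "\<bar>T (unit_vec n i) $ k\<bar> \<le> 1" if "k < K" "i < n" for k i
      using abs_matrix_entry_le_op_norm[OF T \<open>p > 0\<close> that] T1 by linarith
    show "(\<Sum>k<K. \<bar>P (unit_vec K k) $ i\<bar>) \<le> B" if "i < n" for i
      using matrix_row_sum_le_op_norm[OF P \<open>K > 0\<close> \<open>p > 0\<close> that] PB by linarith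
    show "(\<Sum>k<K. P (unit_vec K k) $ i * T (unit_vec n j) $ k) = (if i = j then 1 else 0)"
      if "i < n" "j < n" for i j
    proof -
      have "P (T (unit_vec n j)) $ i = (\<Sum>k<K. P (unit_vec K k) $ i * T (unit_vec n j) $ k)"
        using linear_vec_map_nth[OF P linear_vec_map_carrier[OF T], of "unit_vec n j" i] that
        by (simp add: mult.commute)
      then show ?thesis
        using PT[of "unit_vec n j"] that by simp
    qed
  qed (use assms in auto)
  define x where "x = vec K (\<lambda>k. z k / b)"
  have x: "x \<in> carrier_vec K" "\<And>k. k < K \<Longrightarrow> \<bar>x $ k\<bar> \<le> 1"
    using z(1) \<open>b > 0\<close> by (auto simp: x_def)
  have dim: "dim_vec (P x) = n"
    using linear_vec_map_carrier[OF P x(1)] by auto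
  have ge: "1 / (2 * b) \<le> \<bar>P x $ i\<bar>" if i: "i < n" for i
  proof -
    have "P x $ i = (\<Sum>k<K. P (unit_vec K k) $ i * z k) / b"
      unfolding linear_vec_map_nth[OF P x(1) i] sum_divide_distrib
      by (intro sum.cong) (auto simp: x_def)
    then show ?thesis
      using divide_right_mono[OF z(2)[OF i], of b] \<open>b > 0\<close> by simp
  qed
  have "real n powr (1 / p) * (1 / (2 * b)) \<le> lp_norm p (P x)"
    using lp_norm_const_le[of p "1 / (2 * b)" "P x"] ge dim \<open>p > 0\<close> \<open>b > 0\<close> by simp
  also have "\<dots> \<le> op_norm K linf_norm (lp_norm p) P"
    using P \<open>K > 0\<close> \<open>p > 0\<close> x by (intro lp_norm_le_op_norm) auto
  finally show ?thesis
    by simp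
qed

lemma ln_two_ge: "ln (real 2) \<ge> 1 / 2"
  using ln_le_minus_one[of "1 / 2 :: real"] by (simp add: ln_div)

text \<open>With this \<open>b\<close> the Gaussian factor is \<open>n powr (- M)\<close>. The other powers of \<open>n\<close> on the left
  multiply to \<open>n powr (1 / p + 3 / 2)\<close>, and \<open>M\<close> exceeds that exponent by \<open>3\<close>, enough to absorb
  the factor \<open>4 / b \<le> 4\<close> for every \<open>n \<ge> 2\<close>.\<close>

lemma truncation_height_suffices:
  fixes p :: real and n :: nat
  assumes "p > 0" "n \<ge> 2"
  defines "M \<equiv> 1 / p + 9 / 2"
  defines "b \<equiv> sqrt (4 * M * real n * ln (real n))"
  shows "real n * real n powr (1 / p - 1 / 2) * (4 * real n / b * exp (- (b\<^sup>2 / (4 * real n))))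
           \<le> 1 / 2"
proof -
  have "1 / p > 0"
    using \<open>p > 0\<close> by simp
  then have M: "M \<ge> 1"
    unfolding M_def by linarith
  have "ln (real n) \<ge> ln (real 2)"
    using \<open>n \<ge> 2\<close> by (subst ln_le_cancel_iff) auto
  then have ln: "ln (real n) \<ge> 1 / 2"
    using ln_two_ge by linarith
  have "2 * (1 / 2) \<le> real n * ln (real n)"
    using ln \<open>n \<ge> 2\<close> by (intro mult_mono) auto
  then have "1 * 1 \<le> M * (real n * ln (real n))"
    using M by (intro mult_mono) auto
  then have arg: "1 \<le> 4 * M * real n * ln (real n)"
    by (simp add: mult.assoc)
  then have b: "b \<ge> 1"
    by (simp add: b_def)
  have "b\<^sup>2 = 4 * M * real n * ln (real n)"
    using arg by (simp add: b_def)
  then have "exp (- (b\<^sup>2 / (4 * real n))) = real n powr (- M)"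
    using \<open>n \<ge> 2\<close> by (simp add: powr_def)
  then have "real n * real n powr (1 / p - 1 / 2) * (4 * real n / b * exp (- (b\<^sup>2 / (4 * real n))))
      = 4 / b * (real n powr 1 * real n powr (1 / p - 1 / 2) * real n powr 1 * real n powr (- M))"
    using \<open>n \<ge> 2\<close> by simp
  also have "\<dots> = 4 / b * real n powr (- 3)"
    unfolding powr_add[symmetric] by (simp add: M_def)
  also have "\<dots> \<le> 4 * 2 powr (- 3)"
    using b \<open>n \<ge> 2\<close> by (intro mult_mono powr_mono2') (auto simp: field_simps)
  also have "\<dots> = 1 / 2"
    by (simp add: powr_minus)
  finally show ?thesis .
qed

theorem corollary2:
  fixes p :: real
  assumes "0 < p" and "p \<le> 1"
  shows "\<exists>C::real. C > 0 \<and>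
    (\<forall>(n::nat) (K::nat) T P.
       n \<ge> 2 \<longrightarrow> K \<ge> 1 \<longrightarrow>
       linear_vec_map n K T \<longrightarrow> linear_vec_map K n P \<longrightarrow>
       (\<forall>x \<in> carrier_vec n. P (T x) = x) \<longrightarrow>
       op_norm n (lp_norm p) linf_norm T = 1 \<longrightarrow>
       op_norm K linf_norm (lp_norm p) P
         \<ge> C * real n powr (1 / p - 1 / 2) * ln (real n) powr (- (1 / 2)))"
proof -
  define M where "M = 1 / p + 9 / 2"
  have "1 / p > 0"
    using \<open>0 < p\<close> by simp
  then have M: "M \<ge> 1"
    unfolding M_def by linarith
  define C where "C = 1 / (4 * sqrt M)"
  have C: "C > 0" "C \<le> 1 / 4"
    using M by (auto simp: C_def field_simps)
  have "op_norm K linf_norm (lp_norm p) P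
      \<ge> C * real n powr (1 / p - 1 / 2) * ln (real n) powr (- (1 / 2))"
    if n: "n \<ge> 2" and K: "K \<ge> 1" and T: "linear_vec_map n K T" and P: "linear_vec_map K n P"
      and PT: "\<forall>x \<in> carrier_vec n. P (T x) = x"
      and T1: "op_norm n (lp_norm p) linf_norm T = 1" for n K T P
  proof -
    define b where "b = sqrt (4 * M * real n * ln (real n))"
    have "ln (real n) \<ge> ln (real 2)"
      using n by (subst ln_le_cancel_iff) auto
    then have ln: "ln (real n) \<ge> 1 / 2"
      using ln_two_ge by linarith
    have ln_powr: "ln (real n) powr (- (1 / 2)) = 1 / sqrt (ln (real n))"
      using ln by (subst powr_minus_divide, subst powr_half_sqrt) auto
    show ?thesis
    proof (cases "op_norm K linf_norm (lp_norm p) P \<le> real n powr (1 / p - 1 / 2)")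
      case True
      have "b > 0"
        using M ln n by (simp add: b_def)
      then have "real n powr (1 / p) / (2 * b) \<le> op_norm K linf_norm (lp_norm p) P"
        using truncation_height_suffices[OF \<open>0 < p\<close> n] n K T P PT T1 True \<open>0 < p\<close>
        by (intro op_norm_left_inverse_ge[where B = "real n powr (1 / p - 1 / 2)" and b = b])
          (auto simp: b_def M_def)
      moreover have "real n powr (1 / p) / (2 * b)
          = C * real n powr (1 / p - 1 / 2) * ln (real n) powr (- (1 / 2))"
        unfolding ln_powr using n
        by (simp add: b_def C_def powr_diff powr_half_sqrt real_sqrt_mult)
      ultimately show ?thesis
        by simp
    next
      case False
      \<comment> \<open>\<open>P\<close> is larger than the claim requires, except that the factor \<open>(ln n) powr (- (1 / 2))\<close>
        exceeds \<open>1\<close> for \<open>n = 2\<close>; the bound \<open>C \<le> 1 / 4\<close> covers this.\<close>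
      have "sqrt (1 / 4) \<le> sqrt (ln (real n))"
        using ln by (intro real_sqrt_le_mono) linarith
      then have "1 / 2 \<le> sqrt (ln (real n))"
        by (simp add: real_sqrt_divide)
      then have "ln (real n) powr (- (1 / 2)) \<le> 2"
        unfolding ln_powr using frac_le[of 1 1 "1 / 2" "sqrt (ln (real n))"] by simp
      then have "C * ln (real n) powr (- (1 / 2)) \<le> 1 / 4 * 2"
        using C by (intro mult_mono) auto
      then have "C * ln (real n) powr (- (1 / 2)) * real n powr (1 / p - 1 / 2)
          \<le> 1 * real n powr (1 / p - 1 / 2)"
        by (intro mult_right_mono) auto
      then show ?thesis
        using False by (simp add: mult_ac)
    qed
  qed
  then show ?thesis
    using C(1) by blast
qed

end
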